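(* Let $Z=(X,Y)$ be a pairwise Markov model, and let $N\ge 2$, positive integers $n_1<\cdots<n_{2N+2}$ with $n_1\geq 2$, a set $\mathcal X^*\subset\mathcal X^{n_{2N+2}}$, $\epsilon>0$ and constants $0<\delta\le\Delta<\infty$ be such that the following three conditions hold. **A1.** For all $k=1,\dots,2N$ and all $x\in\mathcal X^*_{(n_k,n_{k+1})}$: (a) $p_{11}(x)\ge p_{i1}(x)$ for all $i\in\mathcal Y$; (b) $p_{11}(x)\ge p_{1i}(x)$ for all $i\in\mathcal Y$; (c) $p_{11}(x)(1-\epsilon)>p_{ij}(x)$ for all $i,j\in\mathcal Y\setminus\{1\}$. **A2.** (a) $p_{ij}(x)\le\Delta$ for all $i,j\in\mathcal Y$ and all $x\in\mathcal X^*_{(1,n_1)}\cup\mathcal X^*_{(n_{2N+1},n_{2N+2})}$; (b) for all $x\in\mathcal X^*_{(1,n_1)}$: $\mathcal Y^+(x)\ne\emptyset$ and $p_{i1}(x)\ge\delta$ for all $i\in\mathcal Y^+(x)_{(1)}$; (c) for all $x\in\mathcal X^*_{(n_{2N+1},n_{2N+2})}$: $\mathcal Y^+(x)\ne\emptyset$ and $p_{1j}(x)\ge\delta$ for all $j\in\mathcal Y^+(x)_{(2)}$. **A3.** $\dfrac{\Delta}{\delta}(1-\epsilon)^N<1$. Then every element of $\mathcal X^*$ is a $1$-barrier of order $n_{2N+2}-n_{N+1}$. Furthermore, if in addition either the inequalities A1(a) are strict for all $i\ne1$, or the inequalities A1(b) are strict for all $i\neq 1$ (condition **A1'** ), then every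 element of $\mathcal X^*$ is a strong $1$-barrier of order $n_{2N+2}-n_{N+1}$.
   Context: Pairwise Markov model. $\mathcal X$ is a separable metric space with Borel $\sigma$-field $\mathcal B(\mathcal X)$; $\mathcal Y=\{1,\dots,|\mathcal Y|\}$ is finite; $\mathcal Z=\mathcal X\times\mathcal Y$ has the product topology ($\mathcal Y$ discrete) and Borel $\sigma$-field $\mathcal B(\mathcal Z)=\mathcal B(\mathcal X)\otimes2^{\mathcal Y}$. $\mu$ is a $\sigma$-finite measure on $\mathcal B(\mathcal X)$ and $c$ is counting measure on $\mathcal Y$. $q:\mathcal Z^2\to[0,\infty)$, $(z,z')\mapsto q(z|z')$, is measurable and for each $z'\in\mathcal Z$ the function $z\mapsto q(z|z')$ is a probability density with respect to $\mu\times c$. $Z=\{Z_k\}_{k\ge1}=\{(X_k,Y_k)\}_{k\ge1}$ is a homogeneous Markov chain on $\mathcal Z$ with transition kernel $P(Z_2\in A|Z_1=z')=\int_A q(z|z')\,\mu\times c(dz)$, whose initial distribution has a density $p(x_1,y_1)$ with respect to the product of some $\sigma$-finite measure on $\mathcal B(\mathcal X)$ and $c$. $X=\{X_k\}$ is the observation process, $Y=\{Y_k\}$ the hidden process. Write $x_{k:l}=(x_k,\dots,x_l)$. For $n\ge2$, $x_{1:n}\in\mathcal X^n$ and $i,j\in\mathcal Y$, $$p_{ij}(x_{1:n})=\max_{y_{1:n}:\,y_1=i,\,y_n=j}\ \prod_{k=2}^n q(x_k,y_k|x_{k-1},y_{k-1}),\qquad \mathcal Y^+(x_{1:n})=\{(i,j)\in\mathcal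 Y^2:\ p_{ij}(x_{1:n})>0\}.$$ For a set $A$ of vectors of length $n$: $A_{(k)}=\{x_k: x_{1:n}\in A\}$ and $A_{(k,l)}=\{x_{k:l}:x_{1:n}\in A\}$. In particular $\mathcal Y^+(x)_{(1)}$ and $\mathcal Y^+(x)_{(2)}$ are the sets of first and second coordinates of the pairs in $\mathcal Y^+(x)$. Nodes and barriers. For a given observation sequence put $\delta_1(y)=p(x_1,y)$ and, for $t\ge2$, $\delta_t(y)=\max_{y_{1:t}:\,y_t=y}p(x_1,y_1)\prod_{k=2}^t q(x_k,y_k|x_{k-1},y_{k-1})$. Given $x_{1:m}$ and $t<m$, the time $t$ is an $i$-node of order $r=m-t$ if $\delta_t(i)p_{ij}(x_{t:m})\ge\delta_t(k)p_{kj}(x_{t:m})$ for all $j,k\in\mathcal Y$. It is a strong $i$-node of order $r$ if it is an $i$-node of order $r$ and this inequality is strict for every $j$ and every $k\ne i$ for which its left side is positive. A vector $b_{1:M}\in\mathcal X^M$ is a (strong) $i$-barrier of order $r$ (and length $M$) if for any $x_{1:\infty}$ with $x_{m-M+1:m}=b_{1:M}$ for some $m\ge M$, the time $m-r$ is a (strong) $i$-node of order $r$ (with respect to $x_{1:m}$). *)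

theory Defs
  imports "HOL-Probability.Probability"
begin

text \<open>
  The hidden alphabet \<open>{1,...,|Y|}\<close> is the set \<open>{1..K}\<close> of natural numbers. A separable metric
  space is a type in the sort \<open>{metric_space, second_countable_topology}\<close>: for metric spaces,
  separability and second countability agree. \<open>q z z'\<close> stands for $q(z|z')$.
\<close>

definition prod_count :: "nat \<Rightarrow> 'x::topological_space measure \<Rightarrow> ('x \<times> nat) measure" where
  "prod_count K \<mu> = \<mu> \<Otimes>\<^sub>M count_space {1..K}"

text \<open>
  In \<open>markov\<close> the conditioning is on the sigma-field generated by \<open>Z 1, ..., Z k\<close>, presented as the
  sigma-field generated by the tuple of these variables. In \<open>initial\<close> the dominating measure
  \<open>\<nu>\<close> need not be \<open>\<mu>\<close>. Time starts at 1, so \<open>Z 0\<close> is irrelevant.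
\<close>

locale pairwise_markov_model = prob_space M
  for M :: "'w measure" +
  fixes \<mu> :: "'x::{metric_space, second_countable_topology} measure"
    and K :: nat
    and q :: "'x \<times> nat \<Rightarrow> 'x \<times> nat \<Rightarrow> real"
    and p :: "'x \<times> nat \<Rightarrow> real"
    and Z :: "nat \<Rightarrow> 'w \<Rightarrow> 'x \<times> nat"
  assumes K_pos: "K \<ge> 1"
    and sets_mu: "sets \<mu> = sets borel"
    and sigma_finite_mu: "sigma_finite_measure \<mu>"
    and q_measurable:
      "(\<lambda>(z, z'). q z z') \<in> borel_measurable (prod_count K borel \<Otimes>\<^sub>M prod_count K borel)"
    and q_nonneg: "\<And>z z'. z \<in> UNIV \<times> {1..K} \<Longrightarrow> z' \<in> UNIV \<times> {1..K} \<Longrightarrow> q z z' \<ge> 0"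
    and q_density: "\<And>z'. z' \<in> UNIV \<times> {1..K} \<Longrightarrow> (\<integral>\<^sup>+z. ennreal (q z z') \<partial>prod_count K \<mu>) = 1"
    and Z_measurable: "\<And>k. k \<ge> 1 \<Longrightarrow> Z k \<in> measurable M (prod_count K borel)"
    and p_nonneg: "\<And>z. z \<in> UNIV \<times> {1..K} \<Longrightarrow> p z \<ge> 0"
    and initial: "\<exists>\<nu>. sets \<nu> = sets borel \<and> sigma_finite_measure \<nu> \<and>
      distributed M (prod_count K \<nu>) (Z 1) (\<lambda>z. ennreal (p z))"
    and markov: "\<And>k A. k \<ge> 1 \<Longrightarrow> A \<in> sets (prod_count K borel) \<Longrightarrow>
      AE \<omega> in M.
        nn_cond_exp M
          (vimage_algebra (space M) (\<lambda>\<omega>. \<lambda>l\<in>{1..k}. Z l \<omega>) (\<Pi>\<^sub>M l\<in>{1..k}. prod_count K borel))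
          (\<lambda>\<omega>. indicator A (Z (Suc k) \<omega>)) \<omega>
        = (\<integral>\<^sup>+z\<in>A. ennreal (q z (Z k \<omega>)) \<partial>prod_count K \<mu>)"

text \<open>
  Vectors $x_{1:n}$ are lists of length \<open>n\<close>. Indices are 1-based as in the mathematics, so
  $x_k$ is \<open>entry xs k\<close>, and \<open>seg k l xs\<close> is $x_{k:l}$.
\<close>

definition entry :: "'a list \<Rightarrow> nat \<Rightarrow> 'a" where
  "entry xs k = xs ! (k - 1)"

definition seg :: "nat \<Rightarrow> nat \<Rightarrow> 'a list \<Rightarrow> 'a list" where
  "seg k l xs = map (entry xs) [k..<Suc l]"

definition seg_set :: "nat \<Rightarrow> nat \<Rightarrow> 'a list set \<Rightarrow> 'a list set" where
  "seg_set k l A = seg k l ` A"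

definition path_weight ::
    "('x \<times> nat \<Rightarrow> 'x \<times> nat \<Rightarrow> real) \<Rightarrow> 'x list \<Rightarrow> nat list \<Rightarrow> real" where
  "path_weight q xs ys =
     (\<Prod>k = 2..length xs. q (entry xs k, entry ys k) (entry xs (k - 1), entry ys (k - 1)))"

text \<open>
  The first argument after \<open>q\<close> is meant to have length at least 2; then, for \<open>i, j \<in> {1..K}\<close>,
  the maximum is over a nonempty finite set.
\<close>

definition pmax ::
    "nat \<Rightarrow> ('x \<times> nat \<Rightarrow> 'x \<times> nat \<Rightarrow> real) \<Rightarrow> 'x list \<Rightarrow> nat \<Rightarrow> nat \<Rightarrow> real" where
  "pmax K q xs i j =
     Max {path_weight q xs ys | ys.
            length ys = length xs \<and> set ys \<subseteq> {1..K} \<and> entry ys 1 = i \<and> entry ys (length xs) = j}"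

definition Yplus ::
    "nat \<Rightarrow> ('x \<times> nat \<Rightarrow> 'x \<times> nat \<Rightarrow> real) \<Rightarrow> 'x list \<Rightarrow> (nat \<times> nat) set" where
  "Yplus K q xs = {(i, j) \<in> {1..K} \<times> {1..K}. pmax K q xs i j > 0}"

definition delta ::
    "nat \<Rightarrow> ('x \<times> nat \<Rightarrow> 'x \<times> nat \<Rightarrow> real) \<Rightarrow> ('x \<times> nat \<Rightarrow> real) \<Rightarrow> 'x list \<Rightarrow> nat \<Rightarrow> nat \<Rightarrow> real"
  where
  "delta K q p xs t y =
     (if t = 1 then p (entry xs 1, y)
      else Max {p (entry xs 1, entry ys 1) * path_weight q (seg 1 t xs) ys | ys.
                  length ys = t \<and> set ys \<subseteq> {1..K} \<and> entry ys t = y})"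

text \<open>Here \<open>xs\<close> is $x_{1:m}$.\<close>

definition node ::
    "nat \<Rightarrow> ('x \<times> nat \<Rightarrow> 'x \<times> nat \<Rightarrow> real) \<Rightarrow> ('x \<times> nat \<Rightarrow> real) \<Rightarrow> nat \<Rightarrow> nat \<Rightarrow> 'x list \<Rightarrow> nat \<Rightarrow> bool"
  where
  "node K q p i r xs t \<longleftrightarrow>
     1 \<le> t \<and> t < length xs \<and> r = length xs - t \<and>
     (\<forall>j\<in>{1..K}. \<forall>k\<in>{1..K}.
        delta K q p xs t i * pmax K q (seg t (length xs) xs) i j
        \<ge> delta K q p xs t k * pmax K q (seg t (length xs) xs) k j)"

definition strong_node ::
    "nat \<Rightarrow> ('x \<times> nat \<Rightarrow> 'x \<times> nat \<Rightarrow> real) \<Rightarrow> ('x \<times> nat \<Rightarrow> real) \<Rightarrow> nat \<Rightarrow> nat \<Rightarrow> 'x list \<Rightarrow> nat \<Rightarrow> bool"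
  where
  "strong_node K q p i r xs t \<longleftrightarrow>
     node K q p i r xs t \<and>
     (\<forall>j\<in>{1..K}. \<forall>k\<in>{1..K} - {i}.
        delta K q p xs t i * pmax K q (seg t (length xs) xs) i j > 0 \<longrightarrow>
        delta K q p xs t i * pmax K q (seg t (length xs) xs) i j
        > delta K q p xs t k * pmax K q (seg t (length xs) xs) k j)"

text \<open>
  The infinite sequence \<open>x\<close> is indexed from 1, its value at 0 being irrelevant; the length of the
  barrier is \<open>length b\<close>.
\<close>

definition barrier ::
    "nat \<Rightarrow> ('x \<times> nat \<Rightarrow> 'x \<times> nat \<Rightarrow> real) \<Rightarrow> ('x \<times> nat \<Rightarrow> real) \<Rightarrow> nat \<Rightarrow> nat \<Rightarrow> 'x list \<Rightarrow> bool"
  where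
  "barrier K q p i r b \<longleftrightarrow>
     (\<forall>(x :: nat \<Rightarrow> 'x) m. m \<ge> length b \<longrightarrow> map x [m - length b + 1..<Suc m] = b \<longrightarrow>
        node K q p i r (map x [1..<Suc m]) (m - r))"

definition strong_barrier ::
    "nat \<Rightarrow> ('x \<times> nat \<Rightarrow> 'x \<times> nat \<Rightarrow> real) \<Rightarrow> ('x \<times> nat \<Rightarrow> real) \<Rightarrow> nat \<Rightarrow> nat \<Rightarrow> 'x list \<Rightarrow> bool"
  where
  "strong_barrier K q p i r b \<longleftrightarrow>
     (\<forall>(x :: nat \<Rightarrow> 'x) m. m \<ge> length b \<longrightarrow> map x [m - length b + 1..<Suc m] = b \<longrightarrow>
        strong_node K q p i r (map x [1..<Suc m]) (m - r))"

end

theory Submission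
  imports Defs
begin

text \<open>
  Put the word \<open>b\<close> at the end of \<open>x 1, ..., x m\<close> and let \<open>T k\<close> be the time at which entry \<open>n k\<close> of
  \<open>b\<close> is read. The claim at time \<open>t = T (N+1)\<close> separates into two halves: it suffices that state 1
  maximises the prefix score \<open>delta t\<close> and also, for each final state \<open>j\<close>, the suffix score
  \<open>pmax (x t, ..., x m) _ j\<close>. All factors being nonnegative, the two inequalities multiply.

  Both scores come from a max-product recursion over \<open>N\<close> of the segments between consecutive times
  \<open>T k\<close>. The prefix score runs forward from \<open>T 1\<close>, the suffix score runs backward from
  \<open>T (2*N+1)\<close>. At the start of either recursion, the outermost segment gives only
  \<open>u y \<le> (\<Delta>/\<delta>) u 1\<close>: a positive \<open>pmax\<close> is at most \<open>\<Delta>\<close>, and moving its inner end to state 1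
  leaves at least \<open>\<delta>\<close>. Each further segment improves the bound. A path that stays off
  state 1 loses a factor \<open>1 - \<epsilon>\<close> against the path that stays in state 1, whereas a path that
  touches state 1 can be rerouted to stay there from then on without loss. After \<open>k\<close> segments
  \<open>u y \<le> max 1 ((\<Delta>/\<delta>) (1 - \<epsilon>)^k) u 1\<close> (\<open>ratio_bound\<close>), and for \<open>k = N\<close> the maximum is 1.

  For a strong barrier it is enough that one of the two halves is strict. In the last step of the
  recursion, a path arriving from state 1 loses by the strict inequality, and a path arriving from
  another state has ratio at most \<open>max (1 - \<epsilon>) ((\<Delta>/\<delta>) (1 - \<epsilon>)^N) < 1\<close> (\<open>strictly_dominates\<close>).
\<close>

section \<open>Max-product recursions with a dominating state\<close>

text \<open>
  The prefix and the suffix scores are two instances of this recursion. Its transition weights \<open>W\<close>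
  point in the direction of the recursion, so for the suffix scores they are the transposed path
  maxima. The maximum \<open>u (Suc k) y\<close> is presented by attainment, and as an upper bound only for the
  path that stays in the distinguished state \<open>e\<close>.
\<close>

locale dominated_recursion =
  fixes S :: "'s set" and e :: 's and N :: nat
    and u :: "nat \<Rightarrow> 's \<Rightarrow> real" and W :: "nat \<Rightarrow> 's \<Rightarrow> 's \<Rightarrow> real" and r C :: real
  assumes e: "e \<in> S"
    and r: "0 < r" "r < 1"
    and C: "0 \<le> C"
    and u_nonneg: "\<And>k y. k \<le> N \<Longrightarrow> y \<in> S \<Longrightarrow> 0 \<le> u k y"
    and W_nonneg: "\<And>k a y. k < N \<Longrightarrow> a \<in> S \<Longrightarrow> y \<in> S \<Longrightarrow> 0 \<le> W k a y"
    and attained: "\<And>k y. k < N \<Longrightarrow> y \<in> S \<Longrightarrow> \<exists>a\<in>S. u (Suc k) y = u k a * W k a y"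
    and step_e: "\<And>k. k < N \<Longrightarrow> u k e * W k e e \<le> u (Suc k) e"
    and W_e: "\<And>k y. k < N \<Longrightarrow> y \<in> S \<Longrightarrow> W k e y \<le> W k e e"
    and W_off: "\<And>k a y. k < N \<Longrightarrow> a \<in> S - {e} \<Longrightarrow> y \<in> S - {e} \<Longrightarrow> W k a y \<le> r * W k e e"
    and start: "\<And>y. y \<in> S \<Longrightarrow> u 0 y \<le> C * u 0 e"
begin

text \<open>
  The excess factor over 1 shrinks by \<open>r\<close> at every step. A maximiser that comes from \<open>e\<close> is already
  beaten by \<open>e\<close> without any excess, and one that stays off \<open>e\<close> picks up the factor \<open>r\<close>. The truncation
  at 1 records the first possibility.
\<close>

lemma ratio_bound:
  assumes "k \<le> N" "y \<in> S"
  shows "u k y \<le> max 1 (C * r ^ k) * u k e"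
  using assms
proof (induction k arbitrary: y)
  case 0
  have "C * u 0 e \<le> max 1 (C * r ^ 0) * u 0 e"
    using u_nonneg[of 0 e] e by (intro mult_right_mono) auto
  then show ?case using start[OF "0.prems"(2)] by linarith
next
  case (Suc k)
  have k: "k < N" "k \<le> N" using Suc.prems by auto
  have pos: "0 \<le> u (Suc k) e" "0 \<le> u k e * W k e e"
    using u_nonneg[OF Suc.prems(1) e] u_nonneg[OF k(2) e] W_nonneg[OF k(1) e e] by auto
  have one: "u (Suc k) e \<le> max 1 (C * r ^ Suc k) * u (Suc k) e"
    using mult_right_mono[of 1 "max 1 (C * r ^ Suc k)" "u (Suc k) e"] pos by simp
  obtain a where a: "a \<in> S" "u (Suc k) y = u k a * W k a y"
    using attained[OF k(1) Suc.prems(2)] by blast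
  consider "y = e" | "a = e" | "y \<noteq> e" "a \<noteq> e" by blast
  then show ?case
  proof cases
    case 1
    then show ?thesis using one by simp
  next
    case 2
    have "u k a * W k a y \<le> u k e * W k e e"
      using 2 W_e[OF k(1) Suc.prems(2)] u_nonneg[OF k(2) e] by (simp add: mult_left_mono)
    then show ?thesis using a one step_e[OF k(1)] by linarith
  next
    case 3
    have "u k a * W k a y \<le> (max 1 (C * r ^ k) * u k e) * (r * W k e e)"
      using Suc.IH[OF k(2) a(1)] W_off[OF k(1), of a y] 3 a Suc.prems
        W_nonneg[OF k(1) a(1) Suc.prems(2)] u_nonneg[OF k(2) e]
      by (intro mult_mono) auto
    also have "\<dots> = max r (C * r ^ Suc k) * (u k e * W k e e)"
      using r by (auto simp: max_def mult_less_cancel_right not_le algebra_simps)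
    also have "\<dots> \<le> max 1 (C * r ^ Suc k) * u (Suc k) e"
      using r pos step_e[OF k(1)] by (intro mult_mono) auto
    finally show ?thesis using a by simp
  qed
qed

lemma dominates:
  assumes "C * r ^ N \<le> 1" "y \<in> S"
  shows "u N y \<le> u N e"
  using ratio_bound[OF order_refl assms(2)] assms(1) by (simp add: max_def split: if_splits)

text \<open>
  Strictness arises in the last step. A maximiser that comes from \<open>e\<close> loses by the strict
  inequality. One that comes from elsewhere has ratio at most \<open>max 1 (C * r ^ (N - 1))\<close> before the
  step, and the further factor \<open>r\<close> brings this strictly below 1.
\<close>

lemma strictly_dominates:
  assumes small: "C * r ^ N < 1" and N: "0 < N"
    and strict: "\<And>k y. k < N \<Longrightarrow> y \<in> S - {e} \<Longrightarrow> W k e y < W k e e"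
    and pos: "0 < u N e" and y: "y \<in> S - {e}"
  shows "u N y < u N e"
proof -
  obtain k where Nk: "N = Suc k" using N by (cases N) auto
  have k: "k < N" "k \<le> N" using Nk by auto
  have yS: "y \<in> S" using y by simp
  obtain a where a: "a \<in> S" "u N y = u k a * W k a y"
    using attained[OF k(1) yS] Nk by auto
  have Wee: "0 < W k e e" using strict[OF k(1) y] W_nonneg[OF k(1) e yS] by linarith
  show ?thesis
  proof (cases "u k e = 0")
    case True
    then have "u k a = 0" using ratio_bound[OF k(2) a(1)] u_nonneg[OF k(2) a(1)] by simp
    then show ?thesis using a pos by simp
  next
    case False
    then have ue: "0 < u k e" using u_nonneg[OF k(2) e] by simp
    have "u k a * W k a y < u k e * W k e e"
    proof (cases "a = e")
      case True
      then show ?thesis using strict[OF k(1) y] ue by simp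
    next
      case False
      have "u k a * W k a y \<le> (max 1 (C * r ^ k) * u k e) * (r * W k e e)"
        using ratio_bound[OF k(2) a(1)] W_off[OF k(1), of a y] False a y
          W_nonneg[OF k(1) a(1) yS] ue
        by (intro mult_mono) auto
      also have "\<dots> = max r (C * r ^ N) * (u k e * W k e e)"
        using r Nk by (auto simp: max_def mult_less_cancel_right not_le algebra_simps)
      also have "\<dots> < 1 * (u k e * W k e e)"
        using r small ue Wee by (intro mult_strict_right_mono) auto
      finally show ?thesis by simp
    qed
    then show ?thesis using a step_e[OF k(1)] Nk by simp
  qed
qed

end

section \<open>Path maxima over functions of time\<close>

text \<open>
  The path maxima are taken over lists indexed from the beginning of the segment. Describing a path
  by a function of absolute time instead makes paths over adjacent segments directly comparable,
  so that cutting and splicing need no index shifts.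
\<close>

lemma entry_map_upt:
  assumes "1 \<le> k" "a + k \<le> Suc b"
  shows "entry (map x [a..<Suc b]) k = x (a + k - 1)"
  using assms by (simp add: entry_def del: upt_Suc)

lemma seg_map_upt:
  assumes "1 \<le> k" "s + l \<le> m"
  shows "seg k l (map x [s + 1..<Suc m]) = map x [s + k..<Suc (s + l)]"
proof (rule nth_equalityI)
  show "length (seg k l (map x [s + 1..<Suc m])) = length (map x [s + k..<Suc (s + l)])"
    using assms by (simp add: seg_def del: upt_Suc)
next
  fix i assume "i < length (seg k l (map x [s + 1..<Suc m]))"
  then have i: "i < Suc l - k" by (simp add: seg_def del: upt_Suc)
  then have "seg k l (map x [s + 1..<Suc m]) ! i = entry (map x [s + 1..<Suc m]) (k + i)"
    by (simp add: seg_def del: upt_Suc)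
  also have "\<dots> = x (s + k + i)"
    using i assms by (subst entry_map_upt) (auto simp: algebra_simps)
  finally show "seg k l (map x [s + 1..<Suc m]) ! i = map x [s + k..<Suc (s + l)] ! i"
    using i by (simp del: upt_Suc)
qed

text \<open>
  Values outside \<open>{a..b}\<close> are unconstrained, so a path restricts to a subinterval without change.
  There are then infinitely many paths for \<open>K \<ge> 1\<close>, but only finitely many restrictions to \<open>{a..b}\<close>.
\<close>

definition paths :: "nat \<Rightarrow> nat \<Rightarrow> nat \<Rightarrow> (nat \<Rightarrow> nat) set" where
  "paths K a b = {y. \<forall>k\<in>{a..b}. y k \<in> {1..K}}"

lemma lists_eq_path_restrictions:
  assumes "a \<le> b"
  shows "{ys. length ys = Suc b - a \<and> set ys \<subseteq> {1..K}} = (\<lambda>y. map y [a..<Suc b]) ` paths K a b"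
    (is "?L = ?R")
proof
  show "?R \<subseteq> ?L" by (auto simp: paths_def simp del: upt_Suc)
  show "?L \<subseteq> ?R"
  proof
    fix ys assume "ys \<in> ?L"
    then have ys: "length ys = Suc b - a" "set ys \<subseteq> {1..K}" by auto
    have "map (\<lambda>k. ys ! (k - a)) [a..<Suc b] = ys"
      using ys by (intro nth_equalityI) (auto simp del: upt_Suc)
    moreover have "(\<lambda>k. ys ! (k - a)) \<in> paths K a b"
      unfolding paths_def
    proof (intro CollectI ballI)
      fix k assume "k \<in> {a..b}"
      then have "ys ! (k - a) \<in> set ys" using ys(1) by (intro nth_mem) auto
      then show "ys ! (k - a) \<in> {1..K}" using ys(2) by blast
    qed
    ultimately show "ys \<in> ?R" by (metis image_eqI)
  qed
qed

locale trellis =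
  fixes K :: nat
    and q :: "'x \<times> nat \<Rightarrow> 'x \<times> nat \<Rightarrow> real"
    and p :: "'x \<times> nat \<Rightarrow> real"
    and x :: "nat \<Rightarrow> 'x"
  assumes K_pos: "1 \<le> K"
    and q_nonneg: "\<And>z z'. z \<in> UNIV \<times> {1..K} \<Longrightarrow> z' \<in> UNIV \<times> {1..K} \<Longrightarrow> 0 \<le> q z z'"
    and p_nonneg: "\<And>z. z \<in> UNIV \<times> {1..K} \<Longrightarrow> 0 \<le> p z"
begin

definition obs :: "nat \<Rightarrow> nat \<Rightarrow> 'x list" where
  "obs a b = map x [a..<Suc b]"

definition w :: "nat \<Rightarrow> nat \<Rightarrow> (nat \<Rightarrow> nat) \<Rightarrow> real" where
  "w a b y = (\<Prod>k\<in>{a<..b}. q (x k, y k) (x (k - 1), y (k - 1)))"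

lemma path_weight_obs:
  assumes "a \<le> b"
  shows "path_weight q (obs a b) (map y [a..<Suc b]) = w a b y"
proof -
  have "path_weight q (obs a b) (map y [a..<Suc b]) =
      (\<Prod>k\<in>{2..Suc b - a}. q (x (a + k - 1), y (a + k - 1)) (x (a + k - 1 - 1), y (a + k - 1 - 1)))"
    unfolding path_weight_def obs_def
  proof (rule prod.cong)
    show "{2..length (map x [a..<Suc b])} = {2..Suc b - a}" by (simp del: upt_Suc)
    fix k assume "k \<in> {2..Suc b - a}"
    then show "q (entry (map x [a..<Suc b]) k, entry (map y [a..<Suc b]) k)
          (entry (map x [a..<Suc b]) (k - 1), entry (map y [a..<Suc b]) (k - 1)) =
        q (x (a + k - 1), y (a + k - 1)) (x (a + k - 1 - 1), y (a + k - 1 - 1))"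
      using assms by (auto simp: entry_map_upt simp del: upt_Suc)
  qed
  also have "\<dots> = w a b y"
    unfolding w_def
    by (rule prod.reindex_bij_witness[where i = "\<lambda>k. Suc k - a" and j = "\<lambda>k. a + k - 1"])
       (use assms in auto)
  finally show ?thesis .
qed

lemma w_nonneg: "y \<in> paths K a b \<Longrightarrow> 0 \<le> w a b y"
  unfolding w_def
proof (intro prod_nonneg q_nonneg)
  fix k assume "y \<in> paths K a b" "k \<in> {a<..b}"
  moreover from this have "k \<in> {a..b}" "k - 1 \<in> {a..b}" by auto
  ultimately have "y k \<in> {1..K}" "y (k - 1) \<in> {1..K}" unfolding paths_def by blast+
  then show "(x k, y k) \<in> UNIV \<times> {1..K}" "(x (k - 1), y (k - 1)) \<in> UNIV \<times> {1..K}" by auto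
qed

lemma w_split:
  assumes "a \<le> b" "b \<le> c"
  shows "w a c y = w a b y * w b c y"
proof -
  have "{a<..c} = {a<..b} \<union> {b<..c}" using assms by auto
  then show ?thesis unfolding w_def by (simp add: prod.union_disjoint ivl_disj_int)
qed

lemma w_cong:
  assumes "\<And>k. a \<le> k \<Longrightarrow> k \<le> b \<Longrightarrow> y k = y' k"
  shows "w a b y = w a b y'"
  unfolding w_def by (rule prod.cong) (use assms in auto)

lemma w_splice:
  assumes "a \<le> b" "b \<le> c" "y b = y' b"
  shows "w a c (\<lambda>k. if k \<le> b then y k else y' k) = w a b y * w b c y'"
  using assms by (subst w_split[of a b c]) (auto intro!: arg_cong2[where f = "(*)"] w_cong)

lemma splice_in_paths:
  "y \<in> paths K a b \<Longrightarrow> y' \<in> paths K b c \<Longrightarrow> (\<lambda>k. if k \<le> b then y k else y' k) \<in> paths K a c"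
  by (auto simp: paths_def)

lemma finite_path_functional:
  assumes "a \<le> b"
  shows "finite ((\<lambda>y. f (map y [a..<Suc b])) ` paths K a b)"
proof -
  have "finite (f ` {ys. length ys = Suc b - a \<and> set ys \<subseteq> {1..K}})"
    using finite_lists_length_eq[of "{1..K}" "Suc b - a"] by (simp add: conj_commute)
  then show ?thesis unfolding lists_eq_path_restrictions[OF assms] image_image .
qed

lemma pmax_eq_Max:
  assumes "a < b"
  shows "pmax K q (obs a b) i j = Max (w a b ` {y \<in> paths K a b. y a = i \<and> y b = j})"
proof -
  have len: "length (obs a b) = Suc b - a" by (simp add: obs_def del: upt_Suc)
  have ends: "entry (map y [a..<Suc b]) 1 = y a" "entry (map y [a..<Suc b]) (Suc b - a) = y b"
    for y :: "nat \<Rightarrow> nat"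
    using assms by (auto simp: entry_map_upt simp del: upt_Suc)
  have "{path_weight q (obs a b) ys | ys. length ys = length (obs a b) \<and> set ys \<subseteq> {1..K} \<and>
            entry ys 1 = i \<and> entry ys (length (obs a b)) = j} =
      path_weight q (obs a b) ` {ys \<in> {ys. length ys = Suc b - a \<and> set ys \<subseteq> {1..K}}.
            entry ys 1 = i \<and> entry ys (Suc b - a) = j}"
    unfolding len by auto
  also have "\<dots> = path_weight q (obs a b) ` (\<lambda>y. map y [a..<Suc b]) `
      {y \<in> paths K a b. y a = i \<and> y b = j}"
    unfolding lists_eq_path_restrictions[OF less_imp_le[OF assms]] using ends
    by (intro arg_cong[where f = "(`) _"]) (auto simp del: upt_Suc)
  also have "\<dots> = w a b ` {y \<in> paths K a b. y a = i \<and> y b = j}"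
    using assms by (simp add: image_image path_weight_obs del: upt_Suc)
  finally show ?thesis unfolding pmax_def by simp
qed

lemma finite_w:
  assumes "a \<le> b"
  shows "finite (w a b ` {y \<in> paths K a b. P y})"
proof (rule finite_subset)
  show "finite (w a b ` paths K a b)"
    using finite_path_functional[OF assms, of "path_weight q (obs a b)"] assms
    by (simp add: path_weight_obs del: upt_Suc)
qed auto

lemma pmax_ge:
  assumes "a < b" "y \<in> paths K a b"
  shows "w a b y \<le> pmax K q (obs a b) (y a) (y b)"
  unfolding pmax_eq_Max[OF assms(1)]
  by (rule Max_ge[OF finite_w]) (use assms in auto)

lemma pmax_attained:
  assumes "a < b" "i \<in> {1..K}" "j \<in> {1..K}"
  obtains y where "y \<in> paths K a b" "y a = i" "y b = j" "pmax K q (obs a b) i j = w a b y"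
proof -
  let ?P = "{y \<in> paths K a b. y a = i \<and> y b = j}"
  have "(\<lambda>k. if k = a then i else j) \<in> ?P" using assms by (auto simp: paths_def)
  then have "w a b ` ?P \<noteq> {}" by blast
  moreover have "finite (w a b ` ?P)"
    using assms by (intro finite_w) auto
  ultimately have "Max (w a b ` ?P) \<in> w a b ` ?P" by (rule Max_in[rotated])
  then show thesis using that unfolding pmax_eq_Max[OF assms(1)] by auto
qed

lemma pmax_nonneg:
  assumes "a < b" "i \<in> {1..K}" "j \<in> {1..K}"
  shows "0 \<le> pmax K q (obs a b) i j"
  using pmax_attained[OF assms] w_nonneg by metis

text \<open>
  Splicing two optimal paths at their common state gives a competitor on the joint segment.
  Conversely, an optimal path on the joint segment splits at its own state at the cut.
\<close>

lemma pmax_concat_le: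
  assumes "a < b" "b < c" "i \<in> {1..K}" "l \<in> {1..K}" "j \<in> {1..K}"
  shows "pmax K q (obs a b) i l * pmax K q (obs b c) l j \<le> pmax K q (obs a c) i j"
proof -
  obtain y where y: "y \<in> paths K a b" "y a = i" "y b = l" "pmax K q (obs a b) i l = w a b y"
    using pmax_attained assms by metis
  obtain y' where y': "y' \<in> paths K b c" "y' b = l" "y' c = j" "pmax K q (obs b c) l j = w b c y'"
    using pmax_attained assms by metis
  show ?thesis
    using pmax_ge[of a c, OF _ splice_in_paths[OF y(1) y'(1)]] w_splice[of a b c y y'] y y' assms
    by simp
qed

lemma pmax_concat:
  assumes "a < b" "b < c" "i \<in> {1..K}" "j \<in> {1..K}"
  shows "\<exists>l\<in>{1..K}. pmax K q (obs a c) i j = pmax K q (obs a b) i l * pmax K q (obs b c) l j"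
proof -
  have "a < c" using assms by simp
  then obtain y where y: "y \<in> paths K a c" "y a = i" "y c = j" "pmax K q (obs a c) i j = w a c y"
    using pmax_attained assms by metis
  have yp: "y \<in> paths K a b" "y \<in> paths K b c" and l: "y b \<in> {1..K}"
    using y(1) assms by (auto simp: paths_def)
  have "w a c y \<le> pmax K q (obs a b) i (y b) * pmax K q (obs b c) (y b) j"
    using pmax_ge[OF assms(1) yp(1)] pmax_ge[OF assms(2) yp(2)] y w_nonneg[OF yp(1)]
      w_nonneg[OF yp(2)] assms
    by (subst w_split[of a b c]) (auto intro: mult_mono)
  then show ?thesis using pmax_concat_le[OF assms(1-3) l assms(4)] y l by (intro bexI[of _ "y b"]) auto
qed

section \<open>Prefix scores\<close>

text \<open>
  The case distinction in the definition of \<open>delta\<close> disappears here: for \<open>t = 1\<close> the product \<open>w 1 1 y\<close>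
  is empty and \<open>score 1 y\<close> is the initial density.
\<close>

definition score :: "nat \<Rightarrow> (nat \<Rightarrow> nat) \<Rightarrow> real" where
  "score t y = p (x 1, y 1) * w 1 t y"

abbreviation dl :: "nat \<Rightarrow> nat \<Rightarrow> nat \<Rightarrow> real" where
  "dl m \<equiv> delta K q p (obs 1 m)"

lemma score_nonneg: "1 \<le> t \<Longrightarrow> y \<in> paths K 1 t \<Longrightarrow> 0 \<le> score t y"
  unfolding score_def by (intro mult_nonneg_nonneg p_nonneg w_nonneg) (auto simp: paths_def)

lemma delta_eq_Max:
  assumes t: "1 \<le> t" "t \<le> m" and j: "j \<in> {1..K}"
  shows "dl m t j = Max (score t ` {y \<in> paths K 1 t. y t = j})"
proof -
  have x1: "entry (obs 1 m) 1 = x 1"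
    using t unfolding obs_def by (subst entry_map_upt) auto
  show ?thesis
  proof (cases "t = 1")
    case True
    have "(\<lambda>k. j) \<in> {y \<in> paths K 1 t. y t = j}" using j by (auto simp: paths_def)
    then have "score t ` {y \<in> paths K 1 t. y t = j} = {p (x 1, j)}"
      using True by (auto simp: score_def w_def image_iff)
    then show ?thesis using True x1 by (simp add: delta_def)
  next
    case False
    have seg: "seg 1 t (obs 1 m) = obs 1 t"
      using seg_map_upt[of 1 0 t m x] t by (simp add: obs_def del: upt_Suc)
    have ends: "entry (map y [1..<Suc t]) 1 = y 1" "entry (map y [1..<Suc t]) t = y t"
      for y :: "nat \<Rightarrow> nat"
      using t by (auto simp: entry_map_upt simp del: upt_Suc)
    have "{p (x 1, entry ys 1) * path_weight q (obs 1 t) ys | ys.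
            length ys = t \<and> set ys \<subseteq> {1..K} \<and> entry ys t = j} =
        (\<lambda>ys. p (x 1, entry ys 1) * path_weight q (obs 1 t) ys) `
          {ys \<in> {ys. length ys = Suc t - 1 \<and> set ys \<subseteq> {1..K}}. entry ys t = j}"
      by auto
    also have "\<dots> = (\<lambda>ys. p (x 1, entry ys 1) * path_weight q (obs 1 t) ys) `
        (\<lambda>y. map y [1..<Suc t]) ` {y \<in> paths K 1 t. y t = j}"
      unfolding lists_eq_path_restrictions[OF t(1)] using ends
      by (intro arg_cong[where f = "(`) _"]) (auto simp del: upt_Suc)
    also have "\<dots> = score t ` {y \<in> paths K 1 t. y t = j}"
      unfolding image_image score_def path_weight_obs[OF t(1)] ends ..
    finally show ?thesis using False unfolding delta_def seg x1 by simp
  qed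
qed

lemma finite_score:
  assumes t: "1 \<le> t"
  shows "finite (score t ` {y \<in> paths K 1 t. P y})"
proof (rule finite_subset)
  have "entry (map y [1..<Suc t]) 1 = y 1" for y :: "nat \<Rightarrow> nat"
    using t by (auto simp: entry_map_upt simp del: upt_Suc)
  then show "finite (score t ` paths K 1 t)"
    using finite_path_functional[OF t, of "\<lambda>ys. p (x 1, entry ys 1) * path_weight q (obs 1 t) ys"] t
    unfolding score_def by (simp add: path_weight_obs[OF t] del: upt_Suc One_nat_def)
qed auto

lemma delta_ge:
  assumes "1 \<le> t" "t \<le> m" "y \<in> paths K 1 t"
  shows "score t y \<le> dl m t (y t)"
proof -
  have "y t \<in> {1..K}" using assms by (auto simp: paths_def)
  then show ?thesis
    using assms by (subst delta_eq_Max) (auto intro!: Max_ge finite_score simp del: One_nat_def)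
qed

lemma delta_attained:
  assumes "1 \<le> t" "t \<le> m" "j \<in> {1..K}"
  obtains y where "y \<in> paths K 1 t" "y t = j" "dl m t j = score t y"
proof -
  let ?P = "{y \<in> paths K 1 t. y t = j}"
  have "(\<lambda>k. j) \<in> ?P" using assms by (auto simp: paths_def)
  then have "score t ` ?P \<noteq> {}" by blast
  moreover have "finite (score t ` ?P)"
    using assms by (intro finite_score) auto
  ultimately have "Max (score t ` ?P) \<in> score t ` ?P" by (rule Max_in[rotated])
  then show thesis using that unfolding delta_eq_Max[OF assms] by auto
qed

lemma delta_nonneg:
  assumes "1 \<le> t" "t \<le> m" "j \<in> {1..K}"
  shows "0 \<le> dl m t j"
  using delta_attained[OF assms] score_nonneg[OF assms(1)] by metis

lemma delta_concat_le:
  assumes "1 \<le> a" "a < b" "b \<le> m" "l \<in> {1..K}" "j \<in> {1..K}"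
  shows "dl m a l * pmax K q (obs a b) l j \<le> dl m b j"
proof -
  obtain y where y: "y \<in> paths K 1 a" "y a = l" "dl m a l = score a y"
    using delta_attained[of a m l] assms by auto
  obtain y' where y': "y' \<in> paths K a b" "y' a = l" "y' b = j" "pmax K q (obs a b) l j = w a b y'"
    using pmax_attained assms by metis
  let ?z = "\<lambda>k. if k \<le> a then y k else y' k"
  have "score b ?z = score a y * w a b y'"
    using w_splice[of 1 a b y y'] y y' assms by (simp add: score_def)
  then show ?thesis
    using delta_ge[of b m, OF _ _ splice_in_paths[OF y(1) y'(1)]] y y' assms by simp
qed

lemma delta_concat:
  assumes "1 \<le> a" "a < b" "b \<le> m" "j \<in> {1..K}"
  shows "\<exists>l\<in>{1..K}. dl m b j = dl m a l * pmax K q (obs a b) l j"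
proof -
  obtain y where y: "y \<in> paths K 1 b" "y b = j" "dl m b j = score b y"
    using delta_attained[of b m j] assms by auto
  have yp: "y \<in> paths K 1 a" "y \<in> paths K a b" and l: "y a \<in> {1..K}"
    using y(1) assms by (auto simp: paths_def)
  have "score b y = score a y * w a b y"
    using w_split[of 1 a b y] assms by (simp add: score_def)
  also have "\<dots> \<le> dl m a (y a) * pmax K q (obs a b) (y a) j"
    using delta_ge[OF assms(1) _ yp(1), of m] pmax_ge[OF assms(2) yp(2)] y w_nonneg[OF yp(2)]
      score_nonneg[OF assms(1) yp(1)] assms
    by (auto intro!: mult_mono)
  finally show ?thesis using delta_concat_le[OF assms(1-3) l assms(4)] y l
    by (intro bexI[of _ "y a"]) auto
qed

end

section \<open>Observation segments that force a node\<close>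

text \<open>
  The hypotheses of the theorem read at the times where the word occurs in a longer sequence
  \<open>x 1, ..., x m\<close>: the word starts at \<open>t0\<close> and ends at \<open>m\<close>.
\<close>

locale node_forcing = trellis K q p x
  for K :: nat
    and q :: "'x \<times> nat \<Rightarrow> 'x \<times> nat \<Rightarrow> real"
    and p :: "'x \<times> nat \<Rightarrow> real"
    and x :: "nat \<Rightarrow> 'x" +
  fixes T :: "nat \<Rightarrow> nat" and N t0 m :: nat and \<epsilon> \<delta> \<Delta> :: real
  assumes N: "0 < N"
    and T_step: "\<And>k. k \<in> {1..2*N+1} \<Longrightarrow> T k < T (k + 1)"
    and t0: "1 \<le> t0" "t0 < T 1"
    and T_end: "T (2*N+2) = m"
    and eps: "0 < \<epsilon>"
    and delta_Delta: "0 < \<delta>" "\<delta> \<le> \<Delta>"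
    and to_1: "\<And>k i. k \<in> {1..2*N} \<Longrightarrow> i \<in> {1..K} \<Longrightarrow>
      pmax K q (obs (T k) (T (k+1))) i 1 \<le> pmax K q (obs (T k) (T (k+1))) 1 1"
    and from_1: "\<And>k i. k \<in> {1..2*N} \<Longrightarrow> i \<in> {1..K} \<Longrightarrow>
      pmax K q (obs (T k) (T (k+1))) 1 i \<le> pmax K q (obs (T k) (T (k+1))) 1 1"
    and off_1: "\<And>k i j. k \<in> {1..2*N} \<Longrightarrow> i \<in> {1..K} - {1} \<Longrightarrow> j \<in> {1..K} - {1} \<Longrightarrow>
      pmax K q (obs (T k) (T (k+1))) i j < pmax K q (obs (T k) (T (k+1))) 1 1 * (1 - \<epsilon>)"
    and first_le: "\<And>i j. i \<in> {1..K} \<Longrightarrow> j \<in> {1..K} \<Longrightarrow> pmax K q (obs t0 (T 1)) i j \<le> \<Delta>"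
    and last_le: "\<And>i j. i \<in> {1..K} \<Longrightarrow> j \<in> {1..K} \<Longrightarrow> pmax K q (obs (T (2*N+1)) m) i j \<le> \<Delta>"
    and first_ge: "\<And>i. i \<in> fst ` Yplus K q (obs t0 (T 1)) \<Longrightarrow>
      \<delta> \<le> pmax K q (obs t0 (T 1)) i 1"
    and last_ge: "\<And>j. j \<in> snd ` Yplus K q (obs (T (2*N+1)) m) \<Longrightarrow>
      \<delta> \<le> pmax K q (obs (T (2*N+1)) m) 1 j"
    and damping: "\<Delta> / \<delta> * (1 - \<epsilon>) ^ N < 1"
begin

lemma T_less: "1 \<le> k \<Longrightarrow> k < l \<Longrightarrow> l \<le> 2*N+2 \<Longrightarrow> T k < T l"
proof (induction l)
  case (Suc l)
  then show ?case using T_step[of l] by (cases "k = l") auto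
qed simp

lemma backward_T_less:
  assumes "k < N"
  shows "T (2*N-k) < T (2*N-k+1)" "T (2*N-k+1) < m"
  using T_less[of "2*N-k" "2*N-k+1"] T_less[of "2*N-k+1" "2*N+2"] assms T_end by linarith+

lemma T_le_m: "1 \<le> k \<Longrightarrow> k \<le> 2*N+2 \<Longrightarrow> T k \<le> m"
  using T_less[of k "2*N+2"] T_end by (cases "k = 2*N+2") auto

lemma T_pos: "1 \<le> k \<Longrightarrow> k \<le> 2*N+2 \<Longrightarrow> 1 \<le> T k"
  using T_less[of 1 k] t0 by (cases "k = 1") auto

text \<open>
  With a second state available, the strict bound on paths off state 1 makes
  \<open>pmax _ 1 1 * (1 - \<epsilon>)\<close> positive. With a single state there is nothing to compare, and \<open>\<epsilon>\<close> may
  exceed 1.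
\<close>

lemma eps_less_1:
  assumes "2 \<le> K"
  shows "\<epsilon> < 1"
proof -
  have k: "2 \<in> {1..K} - {1::nat}" and one: "1 \<in> {1..2*N}" "1 \<in> {1..K}" using assms N by auto
  have "0 \<le> pmax K q (obs (T 1) (T (1+1))) 2 2" "0 \<le> pmax K q (obs (T 1) (T (1+1))) 1 1"
    using T_step[of 1] k one by (auto intro!: pmax_nonneg)
  then have "0 < pmax K q (obs (T 1) (T (1+1))) 1 1 * (1 - \<epsilon>)"
    "0 \<le> pmax K q (obs (T 1) (T (1+1))) 1 1"
    using off_1[OF one(1) k k] by linarith+
  then show ?thesis by (auto simp: zero_less_mult_iff)
qed

text \<open>
  This bound and its mirror image \<open>ratio_last\<close> start the recursions. If the left side is 0 there is
  nothing to show; otherwise \<open>(i, j)\<close> belongs to \<open>Yplus\<close>, so the maximum on the right is at least \<open>\<delta>\<close>.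
\<close>

lemma ratio_first:
  assumes "i \<in> {1..K}" "j \<in> {1..K}"
  shows "pmax K q (obs t0 (T 1)) i j \<le> \<Delta> / \<delta> * pmax K q (obs t0 (T 1)) i 1"
proof (cases "pmax K q (obs t0 (T 1)) i j > 0")
  case True
  then have "(i, j) \<in> Yplus K q (obs t0 (T 1))" using assms by (auto simp: Yplus_def)
  then have "\<delta> \<le> pmax K q (obs t0 (T 1)) i 1" by (intro first_ge) force
  then have "\<Delta> / \<delta> * \<delta> \<le> \<Delta> / \<delta> * pmax K q (obs t0 (T 1)) i 1"
    using delta_Delta by (intro mult_left_mono) auto
  then show ?thesis using first_le[OF assms] delta_Delta by simp
next
  case False
  have "0 \<le> \<Delta> / \<delta> * pmax K q (obs t0 (T 1)) i 1"
    using delta_Delta pmax_nonneg[OF t0(2) assms(1), of 1] K_pos by simp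
  then show ?thesis using False by linarith
qed

lemma ratio_last:
  assumes "i \<in> {1..K}" "j \<in> {1..K}"
  shows "pmax K q (obs (T (2*N+1)) m) i j \<le> \<Delta> / \<delta> * pmax K q (obs (T (2*N+1)) m) 1 j"
proof (cases "pmax K q (obs (T (2*N+1)) m) i j > 0")
  case True
  then have "(i, j) \<in> Yplus K q (obs (T (2*N+1)) m)" using assms by (auto simp: Yplus_def)
  then have "\<delta> \<le> pmax K q (obs (T (2*N+1)) m) 1 j" by (intro last_ge) force
  then have "\<Delta> / \<delta> * \<delta> \<le> \<Delta> / \<delta> * pmax K q (obs (T (2*N+1)) m) 1 j"
    using delta_Delta by (intro mult_left_mono) auto
  then show ?thesis using last_le[OF assms] delta_Delta by simp
next
  case False
  have "0 \<le> \<Delta> / \<delta> * pmax K q (obs (T (2*N+1)) m) 1 j"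
    using delta_Delta pmax_nonneg[OF _ _ assms(2), of "T (2*N+1)" m 1] K_pos T_step[of "2*N+1"] T_end
    by simp
  then show ?thesis using False by linarith
qed

lemma prefix_recursion:
  assumes "2 \<le> K"
  shows "dominated_recursion {1..K} 1 N (\<lambda>k. dl m (T (k + 1)))
    (\<lambda>k. pmax K q (obs (T (k + 1)) (T (k + 1 + 1)))) (1 - \<epsilon>) (\<Delta> / \<delta>)"
proof unfold_locales
  show "1 \<in> {1..K}" "0 < 1 - \<epsilon>" "1 - \<epsilon> < 1" "0 \<le> \<Delta> / \<delta>"
    using K_pos eps eps_less_1[OF assms] delta_Delta by auto
next
  fix k y assume "k \<le> N" "y \<in> {1..K}"
  then show "0 \<le> dl m (T (k + 1)) y"
    using T_pos[of "k + 1"] T_le_m[of "k + 1"] by (intro delta_nonneg) auto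
next
  fix k a y assume "k < N" "a \<in> {1..K}" "y \<in> {1..K}"
  then show "0 \<le> pmax K q (obs (T (k + 1)) (T (k + 1 + 1))) a y"
    using T_step[of "k + 1"] by (intro pmax_nonneg) auto
next
  fix k y assume "k < N" "y \<in> {1..K}"
  then show "\<exists>a\<in>{1..K}. dl m (T (Suc k + 1)) y =
      dl m (T (k + 1)) a * pmax K q (obs (T (k + 1)) (T (k + 1 + 1))) a y"
    using delta_concat[of "T (k + 1)" "T (k + 1 + 1)" m y] T_step[of "k + 1"] T_pos[of "k + 1"]
      T_le_m[of "k + 1 + 1"] by simp
next
  fix k assume "k < N"
  then show "dl m (T (k + 1)) 1 * pmax K q (obs (T (k + 1)) (T (k + 1 + 1))) 1 1
      \<le> dl m (T (Suc k + 1)) 1"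
    using delta_concat_le[of "T (k + 1)" "T (k + 1 + 1)" m 1 1] T_step[of "k + 1"] T_pos[of "k + 1"]
      T_le_m[of "k + 1 + 1"] K_pos by simp
next
  fix k y assume "k < N" "y \<in> {1..K}"
  then show "pmax K q (obs (T (k + 1)) (T (k + 1 + 1))) 1 y
      \<le> pmax K q (obs (T (k + 1)) (T (k + 1 + 1))) 1 1"
    by (intro from_1) auto
next
  fix k a y assume "k < N" "a \<in> {1..K} - {1}" "y \<in> {1..K} - {1}"
  then show "pmax K q (obs (T (k + 1)) (T (k + 1 + 1))) a y
      \<le> (1 - \<epsilon>) * pmax K q (obs (T (k + 1)) (T (k + 1 + 1))) 1 1"
    using off_1[of "k + 1" a y] by (simp add: mult.commute)
next
  fix y assume y: "y \<in> {1..K}"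
  have b: "T 1 \<le> m" using T_le_m[of 1] by simp
  obtain l where l: "l \<in> {1..K}" "dl m (T 1) y = dl m t0 l * pmax K q (obs t0 (T 1)) l y"
    using delta_concat[OF t0 b y] by blast
  have nn: "0 \<le> dl m t0 l" using t0 b l(1) by (intro delta_nonneg) auto
  have "dl m (T 1) y \<le> dl m t0 l * (\<Delta> / \<delta> * pmax K q (obs t0 (T 1)) l 1)"
    unfolding l(2) by (intro mult_left_mono ratio_first nn l(1) y)
  also have "\<dots> = \<Delta> / \<delta> * (dl m t0 l * pmax K q (obs t0 (T 1)) l 1)" by simp
  also have "\<dots> \<le> \<Delta> / \<delta> * dl m (T 1) 1"
    using delta_Delta K_pos by (intro mult_left_mono delta_concat_le t0 b l(1)) auto
  finally show "dl m (T (0 + 1)) y \<le> \<Delta> / \<delta> * dl m (T (0 + 1)) 1" by simp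
qed

text \<open>
  Step \<open>k\<close> of the backward recursion prepends the segment from \<open>T (2*N-k)\<close> to \<open>T (2*N-k+1)\<close>. Read
  backwards, a transition into state 1 becomes a transition out of it; hence the prefix scores
  use \<open>from_1\<close> and the suffix scores \<open>to_1\<close>.
\<close>

lemma suffix_recursion:
  assumes "2 \<le> K" and j: "j \<in> {1..K}"
  shows "dominated_recursion {1..K} 1 N (\<lambda>k i. pmax K q (obs (T (2*N+1-k)) m) i j)
    (\<lambda>k a i. pmax K q (obs (T (2*N-k)) (T (2*N-k+1))) i a) (1 - \<epsilon>) (\<Delta> / \<delta>)"
proof unfold_locales
  show "1 \<in> {1..K}" "0 < 1 - \<epsilon>" "1 - \<epsilon> < 1" "0 \<le> \<Delta> / \<delta>"
    using K_pos eps eps_less_1[OF assms(1)] delta_Delta by auto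
next
  fix k y assume "k \<le> N" "y \<in> {1..K}"
  then show "0 \<le> pmax K q (obs (T (2*N+1-k)) m) y j"
    using T_less[of "2*N+1-k" "2*N+2"] T_end j by (intro pmax_nonneg) auto
next
  fix k a y assume "k < N" and ay: "a \<in> {1..K}" "y \<in> {1..K}"
  then show "0 \<le> pmax K q (obs (T (2*N-k)) (T (2*N-k+1))) y a"
    using ay by (intro pmax_nonneg backward_T_less)
next
  fix k y assume k: "k < N" and y: "y \<in> {1..K}"
  note less = backward_T_less[OF k]
  have idx: "2*N+1 - Suc k = 2*N-k" "2*N+1-k = 2*N-k+1" using k by auto
  show "\<exists>a\<in>{1..K}. pmax K q (obs (T (2*N+1 - Suc k)) m) y j =
      pmax K q (obs (T (2*N+1-k)) m) a j * pmax K q (obs (T (2*N-k)) (T (2*N-k+1))) y a"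
    unfolding idx using pmax_concat[OF less y j] by (simp add: mult.commute)
next
  fix k assume k: "k < N"
  note less = backward_T_less[OF k]
  have idx: "2*N+1 - Suc k = 2*N-k" "2*N+1-k = 2*N-k+1" using k by auto
  show "pmax K q (obs (T (2*N+1-k)) m) 1 j * pmax K q (obs (T (2*N-k)) (T (2*N-k+1))) 1 1
      \<le> pmax K q (obs (T (2*N+1 - Suc k)) m) 1 j"
    unfolding idx using pmax_concat_le[OF less _ _ j, of 1 1] K_pos by (simp add: mult.commute)
next
  fix k y assume "k < N" "y \<in> {1..K}"
  then show "pmax K q (obs (T (2*N-k)) (T (2*N-k+1))) y 1
      \<le> pmax K q (obs (T (2*N-k)) (T (2*N-k+1))) 1 1"
    by (intro to_1) auto
next
  fix k a y assume k: "k < N" and ay: "a \<in> {1..K} - {1}" "y \<in> {1..K} - {1}"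
  have "2*N-k \<in> {1..2*N}" using k by auto
  from off_1[OF this ay(2,1)] show "pmax K q (obs (T (2*N-k)) (T (2*N-k+1))) y a
      \<le> (1 - \<epsilon>) * pmax K q (obs (T (2*N-k)) (T (2*N-k+1))) 1 1"
    by (simp add: mult.commute)
next
  fix y assume "y \<in> {1..K}"
  then show "pmax K q (obs (T (2*N+1-0)) m) y j \<le> \<Delta> / \<delta> * pmax K q (obs (T (2*N+1-0)) m) 1 j"
    using ratio_last j by simp
qed

lemma delta_le_delta_1:
  assumes "k \<in> {1..K}"
  shows "dl m (T (N+1)) k \<le> dl m (T (N+1)) 1"
proof (cases "k = 1")
  case False
  then interpret dominated_recursion "{1..K}" 1 N "\<lambda>k. dl m (T (k + 1))"
    "\<lambda>k. pmax K q (obs (T (k + 1)) (T (k + 1 + 1)))" "1 - \<epsilon>" "\<Delta> / \<delta>"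
    using prefix_recursion assms by auto
  show ?thesis using dominates[OF _ assms] damping by simp
qed simp

lemma suffix_le_suffix_1:
  assumes "k \<in> {1..K}" "j \<in> {1..K}"
  shows "pmax K q (obs (T (N+1)) m) k j \<le> pmax K q (obs (T (N+1)) m) 1 j"
proof (cases "k = 1")
  case False
  then interpret dominated_recursion "{1..K}" 1 N "\<lambda>k i. pmax K q (obs (T (2*N+1-k)) m) i j"
    "\<lambda>k a i. pmax K q (obs (T (2*N-k)) (T (2*N-k+1))) i a" "1 - \<epsilon>" "\<Delta> / \<delta>"
    using suffix_recursion assms by auto
  have "2*N+1-N = N+1" by simp
  then show ?thesis using dominates[OF _ assms(1)] damping by simp
qed simp

lemma delta_less_delta_1:
  assumes strict: "\<And>k i. k \<in> {1..2*N} \<Longrightarrow> i \<in> {1..K} - {1} \<Longrightarrow>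
      pmax K q (obs (T k) (T (k+1))) 1 i < pmax K q (obs (T k) (T (k+1))) 1 1"
    and k: "k \<in> {1..K} - {1}" and pos: "0 < dl m (T (N+1)) 1"
  shows "dl m (T (N+1)) k < dl m (T (N+1)) 1"
proof -
  interpret dominated_recursion "{1..K}" 1 N "\<lambda>k. dl m (T (k + 1))"
    "\<lambda>k. pmax K q (obs (T (k + 1)) (T (k + 1 + 1)))" "1 - \<epsilon>" "\<Delta> / \<delta>"
    using prefix_recursion k by auto
  show ?thesis by (rule strictly_dominates[OF damping N _ pos k]) (intro strict, auto)
qed

lemma suffix_less_suffix_1:
  assumes strict: "\<And>k i. k \<in> {1..2*N} \<Longrightarrow> i \<in> {1..K} - {1} \<Longrightarrow>
      pmax K q (obs (T k) (T (k+1))) i 1 < pmax K q (obs (T k) (T (k+1))) 1 1"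
    and k: "k \<in> {1..K} - {1}" and j: "j \<in> {1..K}"
    and pos: "0 < pmax K q (obs (T (N+1)) m) 1 j"
  shows "pmax K q (obs (T (N+1)) m) k j < pmax K q (obs (T (N+1)) m) 1 j"
proof -
  interpret dominated_recursion "{1..K}" 1 N "\<lambda>k i. pmax K q (obs (T (2*N+1-k)) m) i j"
    "\<lambda>k a i. pmax K q (obs (T (2*N-k)) (T (2*N-k+1))) i a" "1 - \<epsilon>" "\<Delta> / \<delta>"
    using suffix_recursion k j by auto
  have idx: "2*N+1-N = N+1" by simp
  show ?thesis
    by (rule strictly_dominates[OF damping N _ _ k, unfolded idx, OF _ pos]) (intro strict, auto)
qed

lemma seg_obs: "1 \<le> t \<Longrightarrow> seg t m (obs 1 m) = obs t m"
  using seg_map_upt[of t 0 m m x] by (simp add: obs_def del: upt_Suc)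

lemma length_obs: "length (obs 1 m) = m"
  by (simp add: obs_def del: upt_Suc)

lemma middle: "1 \<le> T (N+1)" "T (N+1) < m"
  using T_pos[of "N+1"] T_less[of "N+1" "2*N+2"] T_end by auto

lemma node_at_middle: "node K q p 1 (m - T (N+1)) (obs 1 m) (T (N+1))"
  unfolding node_def length_obs seg_obs[OF middle(1)]
proof (intro conjI ballI)
  fix j k assume j: "j \<in> {1..K}" and k: "k \<in> {1..K}"
  show "dl m (T (N+1)) k * pmax K q (obs (T (N+1)) m) k j
      \<le> dl m (T (N+1)) 1 * pmax K q (obs (T (N+1)) m) 1 j"
    using delta_le_delta_1[OF k] suffix_le_suffix_1[OF k j] delta_nonneg[of "T (N+1)" m 1]
      pmax_nonneg[OF middle(2) k j] middle K_pos
    by (intro mult_mono) auto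
qed (use middle in auto)

lemma strong_node_at_middle:
  assumes strict: "(\<forall>k\<in>{1..2*N}. \<forall>i\<in>{1..K} - {1}.
        pmax K q (obs (T k) (T (k+1))) i 1 < pmax K q (obs (T k) (T (k+1))) 1 1) \<or>
      (\<forall>k\<in>{1..2*N}. \<forall>i\<in>{1..K} - {1}.
        pmax K q (obs (T k) (T (k+1))) 1 i < pmax K q (obs (T k) (T (k+1))) 1 1)"
  shows "strong_node K q p 1 (m - T (N+1)) (obs 1 m) (T (N+1))"
  unfolding strong_node_def length_obs seg_obs[OF middle(1)]
proof (intro conjI ballI impI node_at_middle)
  fix j k assume j: "j \<in> {1..K}" and k: "k \<in> {1..K} - {1}"
    and pos: "0 < dl m (T (N+1)) 1 * pmax K q (obs (T (N+1)) m) 1 j"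
  have kK: "k \<in> {1..K}" using k by simp
  have nn: "0 \<le> dl m (T (N+1)) 1" "0 \<le> dl m (T (N+1)) k" "0 \<le> pmax K q (obs (T (N+1)) m) k j"
    using delta_nonneg[of "T (N+1)" m] pmax_nonneg[OF middle(2) kK j] middle K_pos k by auto
  have d: "0 < dl m (T (N+1)) 1" and s: "0 < pmax K q (obs (T (N+1)) m) 1 j"
    using pos nn(1) by (auto simp: zero_less_mult_iff)
  from strict show "dl m (T (N+1)) k * pmax K q (obs (T (N+1)) m) k j
      < dl m (T (N+1)) 1 * pmax K q (obs (T (N+1)) m) 1 j"
  proof
    assume "\<forall>k\<in>{1..2*N}. \<forall>i\<in>{1..K} - {1}.
        pmax K q (obs (T k) (T (k+1))) i 1 < pmax K q (obs (T k) (T (k+1))) 1 1"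
    then have "pmax K q (obs (T (N+1)) m) k j < pmax K q (obs (T (N+1)) m) 1 j"
      by (intro suffix_less_suffix_1[OF _ k j s]) auto
    then show ?thesis using delta_le_delta_1[OF kK] d nn
      by (meson mult_right_mono mult_strict_left_mono le_less_trans)
  next
    assume "\<forall>k\<in>{1..2*N}. \<forall>i\<in>{1..K} - {1}.
        pmax K q (obs (T k) (T (k+1))) 1 i < pmax K q (obs (T k) (T (k+1))) 1 1"
    then have "dl m (T (N+1)) k < dl m (T (N+1)) 1"
      by (intro delta_less_delta_1[OF _ k d]) auto
    then show ?thesis using suffix_le_suffix_1[OF kK j] s nn
      by (meson mult_left_mono mult_strict_right_mono le_less_trans)
  qed
qed

end

section \<open>The barrier theorem\<close>

theorem theorem2p1:
  fixes M :: "'w measure"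
    and \<mu> :: "'x::{metric_space, second_countable_topology} measure"
    and K N :: nat
    and q :: "'x \<times> nat \<Rightarrow> 'x \<times> nat \<Rightarrow> real"
    and p :: "'x \<times> nat \<Rightarrow> real"
    and Z :: "nat \<Rightarrow> 'w \<Rightarrow> 'x \<times> nat"
    and n :: "nat \<Rightarrow> nat"
    and Xs :: "'x list set"
    and \<epsilon> \<delta> \<Delta> :: real
  assumes model: "pairwise_markov_model M \<mu> K q p Z"
    and N: "N \<ge> 2"
    and n_mono: "\<forall>k\<in>{1..2*N+1}. n k < n (k + 1)"
    and n_1: "n 1 \<ge> 2"
    and Xs: "\<forall>x\<in>Xs. length x = n (2*N+2)"
    and eps: "\<epsilon> > 0"
    and delta: "0 < \<delta>" "\<delta> \<le> \<Delta>"
    and A1a: "\<forall>k\<in>{1..2*N}. \<forall>x\<in>seg_set (n k) (n (k+1)) Xs.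
      \<forall>i\<in>{1..K}. pmax K q x 1 1 \<ge> pmax K q x i 1"
    and A1b: "\<forall>k\<in>{1..2*N}. \<forall>x\<in>seg_set (n k) (n (k+1)) Xs.
      \<forall>i\<in>{1..K}. pmax K q x 1 1 \<ge> pmax K q x 1 i"
    and A1c: "\<forall>k\<in>{1..2*N}. \<forall>x\<in>seg_set (n k) (n (k+1)) Xs.
      \<forall>i\<in>{1..K} - {1}. \<forall>j\<in>{1..K} - {1}. pmax K q x 1 1 * (1 - \<epsilon>) > pmax K q x i j"
    and A2a: "\<forall>x\<in>seg_set 1 (n 1) Xs \<union> seg_set (n (2*N+1)) (n (2*N+2)) Xs.
      \<forall>i\<in>{1..K}. \<forall>j\<in>{1..K}. pmax K q x i j \<le> \<Delta>"
    and A2b: "\<forall>x\<in>seg_set 1 (n 1) Xs.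
      Yplus K q x \<noteq> {} \<and> (\<forall>i\<in>fst ` Yplus K q x. pmax K q x i 1 \<ge> \<delta>)"
    and A2c: "\<forall>x\<in>seg_set (n (2*N+1)) (n (2*N+2)) Xs.
      Yplus K q x \<noteq> {} \<and> (\<forall>j\<in>snd ` Yplus K q x. pmax K q x 1 j \<ge> \<delta>)"
    and A3: "\<Delta> / \<delta> * (1 - \<epsilon>) ^ N < 1"
  shows "(\<forall>b\<in>Xs. barrier K q p 1 (n (2*N+2) - n (N+1)) b) \<and>
    (((\<forall>k\<in>{1..2*N}. \<forall>x\<in>seg_set (n k) (n (k+1)) Xs.
         \<forall>i\<in>{1..K} - {1}. pmax K q x 1 1 > pmax K q x i 1) \<or>
      (\<forall>k\<in>{1..2*N}. \<forall>x\<in>seg_set (n k) (n (k+1)) Xs.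
         \<forall>i\<in>{1..K} - {1}. pmax K q x 1 1 > pmax K q x 1 i))
     \<longrightarrow> (\<forall>b\<in>Xs. strong_barrier K q p 1 (n (2*N+2) - n (N+1)) b))"
proof -
  interpret pairwise_markov_model M \<mu> K q p Z by (rule model)
  let ?L = "n (2*N+2)"
  have n_le: "n k \<le> n l" if "1 \<le> k" "k \<le> l" "l \<le> 2*N+2" for k l
    using that(2,3)
  proof (induction l rule: dec_induct)
    case (step l)
    then show ?case using n_mono[rule_format, of l] that(1) by simp
  qed simp
  \<comment> \<open>Every occurrence of a word of \<open>Xs\<close> that ends at time \<open>m\<close> is shifted by \<open>m - ?L\<close>.\<close>
  have forcing: "node_forcing K q p x (\<lambda>k. m - ?L + n k) N (m - ?L + 1) m \<epsilon> \<delta> \<Delta>"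
    and position: "m - (?L - n (N+1)) = m - ?L + n (N+1)" "?L - n (N+1) = m - (m - ?L + n (N+1))"
    and segments: "\<And>k. k \<in> {1..2*N} \<Longrightarrow>
      map x [m - ?L + n k..<Suc (m - ?L + n (k+1))] \<in> seg_set (n k) (n (k+1)) Xs"
    if b: "b \<in> Xs" and m: "length b \<le> m" and x: "map x [m - length b + 1..<Suc m] = b"
    for b m and x :: "nat \<Rightarrow> 'x"
  proof -
    define s where "s = m - ?L"
    have mL: "m = s + ?L" using Xs b m by (auto simp: s_def)
    have b_eq: "b = map x [s + 1..<Suc m]" using Xs b x by (auto simp: s_def)
    interpret trellis K q p x using K_pos q_nonneg p_nonneg by unfold_locales
    have obs_in: "obs (s + k) (s + l) \<in> seg_set k l Xs" if "1 \<le> k" "l \<le> ?L" for k l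
    proof -
      have "obs (s + k) (s + l) = seg k l b"
        unfolding b_eq obs_def using that mL by (intro seg_map_upt[symmetric]) auto
      then show ?thesis using b unfolding seg_set_def by blast
    qed
    have mid: "obs (s + n k) (s + n (k+1)) \<in> seg_set (n k) (n (k+1)) Xs" if "k \<in> {1..2*N}" for k
      using that n_le[of 1 k] n_le[of "k+1" "2*N+2"] n_1 by (intro obs_in) auto
    have first: "obs (s + 1) (s + n 1) \<in> seg_set 1 (n 1) Xs"
      using n_le[of 1 "2*N+2"] by (intro obs_in) auto
    have last: "obs (s + n (2*N+1)) m \<in> seg_set (n (2*N+1)) (n (2*N+2)) Xs"
      unfolding mL using n_le[of 1 "2*N+1"] n_1 by (intro obs_in) auto
    have "node_forcing K q p x (\<lambda>k. s + n k) N (s + 1) m \<epsilon> \<delta> \<Delta>"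
    proof unfold_locales
      show "0 < N" using N by simp
      show "s + 1 < s + n 1" using n_1 by simp
      show "s + n (2*N+2) = m" using mL by simp
    qed (use n_mono eps delta A3 A1a A1b A1c mid A2a A2b A2c first last in \<open>auto simp del: One_nat_def\<close>)
    then show "node_forcing K q p x (\<lambda>k. m - ?L + n k) N (m - ?L + 1) m \<epsilon> \<delta> \<Delta>"
      by (simp add: s_def)
    show "m - (?L - n (N+1)) = m - ?L + n (N+1)" "?L - n (N+1) = m - (m - ?L + n (N+1))"
      using n_le[of "N+1" "2*N+2"] mL by auto
    show "map x [m - ?L + n k..<Suc (m - ?L + n (k+1))] \<in> seg_set (n k) (n (k+1)) Xs"
      if "k \<in> {1..2*N}" for k
      using mid[OF that] by (simp add: obs_def s_def del: upt_Suc)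
  qed
  show ?thesis
  proof (intro conjI impI ballI)
    fix b assume b: "b \<in> Xs"
    show "barrier K q p 1 (?L - n (N+1)) b"
      unfolding barrier_def
    proof (intro allI impI)
      fix x :: "nat \<Rightarrow> 'x" and m
      assume "length b \<le> m" "map x [m - length b + 1..<Suc m] = b"
      note bm = b this
      interpret node_forcing K q p x "\<lambda>k. m - ?L + n k" N "m - ?L + 1" m \<epsilon> \<delta> \<Delta>
        by (rule forcing[OF bm])
      show "node K q p 1 (?L - n (N+1)) (map x [1..<Suc m]) (m - (?L - n (N+1)))"
        unfolding position(1)[OF bm] using node_at_middle position(2)[OF bm]
        by (simp add: obs_def del: upt_Suc)
    qed
  next
    fix b
    assume strict: "(\<forall>k\<in>{1..2*N}. \<forall>x\<in>seg_set (n k) (n (k+1)) Xs.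
         \<forall>i\<in>{1..K} - {1}. pmax K q x 1 1 > pmax K q x i 1) \<or>
      (\<forall>k\<in>{1..2*N}. \<forall>x\<in>seg_set (n k) (n (k+1)) Xs.
         \<forall>i\<in>{1..K} - {1}. pmax K q x 1 1 > pmax K q x 1 i)"
      and b: "b \<in> Xs"
    show "strong_barrier K q p 1 (?L - n (N+1)) b"
      unfolding strong_barrier_def
    proof (intro allI impI)
      fix x :: "nat \<Rightarrow> 'x" and m
      assume "length b \<le> m" "map x [m - length b + 1..<Suc m] = b"
      note bm = b this
      interpret node_forcing K q p x "\<lambda>k. m - ?L + n k" N "m - ?L + 1" m \<epsilon> \<delta> \<Delta>
        by (rule forcing[OF bm])
      have "strong_node K q p 1 (m - (m - ?L + n (N+1))) (obs 1 m) (m - ?L + n (N+1))"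
        by (rule strong_node_at_middle) (use strict segments[OF bm] in \<open>unfold obs_def, blast\<close>)
      then show "strong_node K q p 1 (?L - n (N+1)) (map x [1..<Suc m]) (m - (?L - n (N+1)))"
        unfolding position(1)[OF bm] using position(2)[OF bm]
        by (simp add: obs_def del: upt_Suc)
    qed
  qed
qed

end
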